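(* Let $\Delta\ge 6$ and let $n=k\Delta+1+j$, where $k\geq\Delta-1$ and $1\leq j\leq\Delta-1$ are integers. Then the family $\mathcal{T}''_{n,\Delta}$ is not empty and all trees in $\mathcal{T}''_{n,\Delta}$ have the same value of $\sigma$-irregularity.
   Context: For a graph $G$, $\sigma(G)=\sum_{uv\in E(G)}(d(u)-d(v))^2$, where $d(u)$ is the degree of $u$. For a tree $T$, $m_{ij}=m_{ji}$ is the number of edges whose end-vertices have degrees $i$ and $j$. An internal leaf of a tree is a vertex of degree at least $2$ having precisely one neighbor of degree greater than $1$. The family $\mathcal{T}''_{n,\Delta}$ consists of all trees $T$ on $n$ vertices with maximum degree $\Delta$ such that: (1) all internal leaves of $T$ have degree $\Delta$; (2) all vertices of $T$ have degree in $\{1,2,\Delta\}$; (3) $m_{22}=0$ and $m_{\Delta\Delta}\le\Delta-1$. *)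

theory Defs
  imports "Graph_Theory.Graph_Theory"
begin

text \<open>
  A finite simple graph is a \<^locale>\<open>pair_graph\<close>: a finite, symmetric, loop-free digraph without
  parallel arcs. An undirected edge \<open>uv\<close> is thus represented by the two arcs \<open>(u, v)\<close> and \<open>(v, u)\<close>.
\<close>

definition edges :: "'a pair_pre_digraph \<Rightarrow> 'a set set" where
  "edges G = {{u, v} | u v. (u, v) \<in> parcs G}"

definition degree :: "'a pair_pre_digraph \<Rightarrow> 'a \<Rightarrow> nat" where
  "degree G v = out_degree (with_proj G) v"

text \<open>
  The library's \<^const>\<open>tree\<close> is not suitable here: in a symmetric digraph the closed walk
  \<open>u, v, u\<close> along a single edge already is a \<^const>\<open>pre_digraph.cycle\<close>.
  The cycles of the undirected graph are exactly those of length at least 3.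
\<close>

definition undirected_tree :: "'a pair_pre_digraph \<Rightarrow> bool" where
  "undirected_tree G \<longleftrightarrow> pair_graph G \<and> connected (with_proj G) \<and>
     \<not> (\<exists>p. pre_digraph.cycle (with_proj G) p \<and> length p \<ge> 3)"

text \<open>
  The set under \<^const>\<open>the_elem\<close> is a singleton, since the two possible orders of the end-vertices
  of an edge give the same square; see \<open>edge_square\<close> below.
\<close>

definition sigma :: "'a pair_pre_digraph \<Rightarrow> int" where
  "sigma G = (\<Sum>e\<in>edges G.
     the_elem {(int (degree G u) - int (degree G v))\<^sup>2 | u v. e = {u, v}})"

lemma edge_square:
  "the_elem {(int (degree G u) - int (degree G v))\<^sup>2 | u v. {x, y} = {u, v}}
     = (int (degree G x) - int (degree G y))\<^sup>2"
proof -
  have "{(int (degree G u) - int (degree G v))\<^sup>2 | u v. {x, y} = {u, v}}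
      = {(int (degree G x) - int (degree G y))\<^sup>2}"
    by (auto simp: doubleton_eq_iff power2_commute)
  then show ?thesis by simp
qed

definition edge_count :: "'a pair_pre_digraph \<Rightarrow> nat \<Rightarrow> nat \<Rightarrow> nat" where
  "edge_count G i j = card {e \<in> edges G. degree G ` e = {i, j}}"

definition max_degree :: "'a pair_pre_digraph \<Rightarrow> nat" where
  "max_degree G = Max (degree G ` pverts G)"

definition internal_leaf :: "'a pair_pre_digraph \<Rightarrow> 'a \<Rightarrow> bool" where
  "internal_leaf G v \<longleftrightarrow> v \<in> pverts G \<and> degree G v \<ge> 2 \<and>
     (\<exists>!u. (v, u) \<in> parcs G \<and> degree G u > 1)"

definition family_T'' :: "nat \<Rightarrow> nat \<Rightarrow> 'a pair_pre_digraph set" where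
  "family_T'' n \<Delta> = {T. undirected_tree T \<and> card (pverts T) = n \<and> max_degree T = \<Delta> \<and>
     (\<forall>v. internal_leaf T v \<longrightarrow> degree T v = \<Delta>) \<and>
     (\<forall>v \<in> pverts T. degree T v \<in> {1, 2, \<Delta>}) \<and>
     edge_count T 2 2 = 0 \<and> edge_count T \<Delta> \<Delta> \<le> \<Delta> - 1}"

end

theory Submission
  imports Defs
begin

text \<open>
  In a tree of the family every edge has an end of degree \<open>\<Delta>\<close>. Let \<open>n\<^sub>1\<close>, \<open>n\<^sub>2\<close>, \<open>N\<close> be the numbers of
  vertices of degree 1, 2, \<open>\<Delta>\<close>, and \<open>c = m\<^bsub>\<Delta>\<Delta>\<^esub>\<close>. Each edge has one end of degree \<open>\<Delta>\<close>,
  except that the \<open>c\<close> edges have two, so \<open>\<Delta> N = (n - 1) + c = k \<Delta> + j + c\<close>. As \<open>1 \<le> j\<close> and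
  \<open>j, c \<le> \<Delta> - 1\<close>, this forces \<open>N = k + 1\<close> and \<open>c = \<Delta> - j\<close>, which determines \<open>n\<^sub>1\<close> and \<open>n\<^sub>2\<close> and
  hence \<open>\<sigma> = n\<^sub>1 (\<Delta> - 1)\<^sup>2 + 2 n\<^sub>2 (\<Delta> - 2)\<^sup>2\<close>. A caterpillar with these counts shows that the
  family is not empty.
\<close>

section \<open>Counting arcs in trees\<close>

context pair_graph
begin

text \<open>The library phrases connectivity through the symmetric closure; the arcs here are
  symmetric already, so directed walks suffice.\<close>

lemma connected_iff:
  "connected (with_proj G) \<longleftrightarrow>
     pverts G \<noteq> {} \<and> (\<forall>u\<in>pverts G. \<forall>v\<in>pverts G. \<exists>p. awalk u p v)"
  using reachable_mk_symmetric_eq[OF pair_sym_arcs] reachable_awalk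
  by (simp add: connected_def strongly_connected_def)

lemma symmetric_arc_iff: "(u, v) \<in> parcs G \<longleftrightarrow> (v, u) \<in> parcs G"
  using arcs_symmetric by blast

lemma awalk_leaves_set:
  assumes "awalk u p v" "u \<in> S" "v \<notin> S"
  shows "\<exists>(x, y)\<in>parcs G. x \<in> S \<and> y \<notin> S"
  using assms
proof (induction p arbitrary: u)
  case Nil
  then show ?case by (auto simp: awalk_Nil_iff)
next
  case (Cons e p)
  then show ?case
    by (cases "snd e \<in> S") (auto simp: awalk_Cons_iff split_def)
qed

lemma connected_leaves_set:
  assumes "connected (with_proj G)" "u \<in> S" "u \<in> pverts G" "\<not> pverts G \<subseteq> S"
  obtains x y where "(x, y) \<in> parcs G" "x \<in> S" "y \<notin> S"
proof -
  obtain v where v: "v \<in> pverts G" "v \<notin> S" using assms(4) by blast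
  then obtain p where "awalk u p v" using assms(1,3) unfolding connected_iff by blast
  from awalk_leaves_set[OF this assms(2) v(2)] show thesis using that by blast
qed

section \<open>Edges as pairs of opposite arcs\<close>

lemma finite_edges: "finite (edges G)"
proof -
  have "edges G = (\<lambda>(u, v). {u, v}) ` parcs G"
    by (auto simp: edges_def)
  then show ?thesis using pair_finite_arcs by simp
qed

text \<open>The fibre over each edge consists of two opposite arcs, distinct because there are no
  loops. Arc sums are preferred later since they split by the degree of either end.\<close>

lemma sum_arcs_eq_twice_sum_edges:
  fixes f :: "'a set \<Rightarrow> int"
  shows "(\<Sum>(u, v)\<in>parcs G. f {u, v}) = 2 * (\<Sum>e\<in>edges G. f e)"
proof -
  have im: "edges G = (\<lambda>(u, v). {u, v}) ` parcs G"
    by (auto simp: edges_def)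
  have "(\<Sum>(u, v)\<in>parcs G. f {u, v})
      = (\<Sum>e\<in>edges G. \<Sum>a\<in>{a \<in> parcs G. (\<lambda>(u, v). {u, v}) a = e}. case a of (u, v) \<Rightarrow> f {u, v})"
    unfolding im using pair_finite_arcs by (rule sum.image_gen)
  also have "\<dots> = (\<Sum>e\<in>edges G. 2 * f e)"
  proof (rule sum.cong)
    fix e assume "e \<in> edges G"
    then obtain u v where uv: "(u, v) \<in> parcs G" "e = {u, v}"
      by (auto simp: edges_def)
    then have "u \<noteq> v" using no_loops' by blast
    have "{a \<in> parcs G. (\<lambda>(u, v). {u, v}) a = e} = {(u, v), (v, u)}"
      using uv symmetric_arc_iff by (auto simp: doubleton_eq_iff)
    then show "(\<Sum>a\<in>{a \<in> parcs G. (\<lambda>(u, v). {u, v}) a = e}. case a of (u, v) \<Rightarrow> f {u, v}) = 2 * f e"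
      using \<open>u \<noteq> v\<close> uv(2) by (simp add: insert_commute)
  qed simp
  finally show ?thesis by (simp add: sum_distrib_left)
qed

lemma twice_sigma:
  "2 * sigma G = (\<Sum>(u, v)\<in>parcs G. (int (degree G u) - int (degree G v))\<^sup>2)"
  unfolding sigma_def sum_arcs_eq_twice_sum_edges[symmetric] edge_square ..

lemma twice_edge_count:
  "2 * edge_count G i j = card {(u, v) \<in> parcs G. {degree G u, degree G v} = {i, j}}"
proof -
  let ?f = "\<lambda>e. if degree G ` e = {i, j} then 1 else (0::int)"
  have card_filter: "int (card {x \<in> A. P x}) = (\<Sum>x\<in>A. if P x then 1 else 0)"
    if "finite A" for A :: "'b set" and P
    using sum.inter_filter[OF that, of "\<lambda>_. 1::int" P] by simp
  have "{(u, v) \<in> parcs G. {degree G u, degree G v} = {i, j}}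
      = {a \<in> parcs G. {degree G (fst a), degree G (snd a)} = {i, j}}"
    by (simp only: split_def) auto
  then have "int (card {(u, v) \<in> parcs G. {degree G u, degree G v} = {i, j}})
      = (\<Sum>(u, v)\<in>parcs G. ?f {u, v})"
    using card_filter[OF pair_finite_arcs]
    by (simp only: split_def image_insert image_empty)
  also have "\<dots> = 2 * (\<Sum>e\<in>edges G. ?f e)"
    by (rule sum_arcs_eq_twice_sum_edges)
  also have "\<dots> = 2 * int (edge_count G i j)"
    unfolding edge_count_def card_filter[OF finite_edges] ..
  finally show ?thesis by linarith
qed

lemma degree_eq_card: "degree G v = card {w. (v, w) \<in> parcs G}"
proof -
  have "out_arcs (with_proj G) v = Pair v ` {w. (v, w) \<in> parcs G}"
    by (auto simp: out_arcs_def)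
  then show ?thesis
    by (simp add: degree_def out_degree_def card_image inj_on_def)
qed

lemma finite_neighbours: "finite {w. (v, w) \<in> parcs G}"
  by (rule finite_subset[OF _ pair_finite_verts]) (auto dest: in_arcsD2)

lemma card_arcs_from:
  assumes "U \<subseteq> pverts G" "\<And>u. u \<in> U \<Longrightarrow> degree G u = d"
  shows "card {(u, v) \<in> parcs G. u \<in> U} = d * card U"
proof -
  have "{(u, v) \<in> parcs G. u \<in> U} = Sigma U (\<lambda>u. {w. (u, w) \<in> parcs G})"
    by auto
  moreover have "finite U"
    using assms(1) pair_finite_verts finite_subset by blast
  ultimately show ?thesis
    using assms(2) finite_neighbours by (simp add: degree_eq_card)
qed

section \<open>The number of edges of a tree\<close>

text \<open>
  The vertex \<open>w\<close> outside a path-connected set \<open>S\<close> has only one neighbour in \<open>S\<close>: two neighbours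
  \<open>x\<close>, \<open>y\<close> and a path from \<open>x\<close> to \<open>y\<close> inside \<open>S\<close> would close a cycle through \<open>w\<close>.
\<close>

lemma acyclic_unique_neighbour:
  assumes "\<not> (\<exists>p. cycle p \<and> length p \<ge> 3)"
    and "apath x p y" "set (awalk_verts x p) \<subseteq> S" "w \<notin> S"
    and "(w, x) \<in> parcs G" "(w, y) \<in> parcs G"
  shows "x = y"
proof (rule ccontr)
  assume "x \<noteq> y"
  then have "p \<noteq> []" using assms(2) by (auto simp: apath_Nil_iff)
  have p: "awalk x p y" "distinct (awalk_verts x p)"
    using assms(2) by (auto simp: apath_def)
  let ?c = "(w, x) # p @ [(y, w)]"
  have yw: "(y, w) \<in> parcs G" using assms(6) symmetric_arc_iff by blast
  have walk: "awalk x (p @ [(y, w)]) w"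
    using p(1) yw by (intro awalk_appendI[of x p y]) (auto simp: awalk_simps in_arcsD2)
  then have "awalk w ?c w" using assms(5) by (simp only: awalk_Cons_iff fst_conv snd_conv simp_thms)
  moreover have "awalk_verts x (p @ [(y, w)]) = awalk_verts x p @ [w]"
    using awalk_verts_append[OF walk] by simp
  then have "distinct (tl (awalk_verts w ?c))"
    using p(2) assms(3,4) by auto
  ultimately have "cycle ?c" by (auto simp: cycle_def)
  moreover have "length ?c \<ge> 3" using \<open>p \<noteq> []\<close> by (cases p) auto
  ultimately show False using assms(1) by blast
qed

text \<open>Paths rather than walks, because closing one through an outside vertex must give a cycle
  without repeated vertices.\<close>

definition path_connected_in :: "'a set \<Rightarrow> bool" where
  "path_connected_in S \<longleftrightarrow>
     (\<forall>x\<in>S. \<forall>y\<in>S. \<exists>p. apath x p y \<and> set (awalk_verts x p) \<subseteq> S)"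

lemma path_connected_in_insert:
  assumes "path_connected_in S" "(w, s) \<in> parcs G" "s \<in> S" "w \<notin> S"
  shows "path_connected_in (insert w S)"
proof -
  have from_w: "\<exists>p. apath w p y \<and> set (awalk_verts w p) \<subseteq> insert w S" if y: "y \<in> S" for y
  proof -
    obtain p where p: "apath s p y" "set (awalk_verts s p) \<subseteq> S"
      using assms(1,3) y unfolding path_connected_in_def by meson
    then have "apath w ((w, s) # p) y" "set (awalk_verts w ((w, s) # p)) \<subseteq> insert w S"
      using assms(2,4) by (auto simp: apath_Cons_iff)
    then show ?thesis by blast
  qed
  have to_w: "\<exists>p. apath x p w \<and> set (awalk_verts x p) \<subseteq> insert w S" if x: "x \<in> S" for x
  proof -
    obtain p where p: "apath w p x" "set (awalk_verts w p) \<subseteq> insert w S"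
      using from_w x by blast
    then have "awalk_verts x (rev_path p) = rev (awalk_verts w p)"
      by (intro awalk_verts_rev_path) (auto simp: apath_def)
    then have "apath x (rev_path p) w" "set (awalk_verts x (rev_path p)) \<subseteq> insert w S"
      using p by auto
    then show ?thesis by blast
  qed
  have "apath w [] w"
    using assms(2) by (auto simp: apath_Nil_iff in_arcsD1)
  then have w_w: "\<exists>p. apath w p w \<and> set (awalk_verts w p) \<subseteq> insert w S"
    by (intro exI[of _ "[]"]) simp
  have S_S: "\<exists>p. apath x p y \<and> set (awalk_verts x p) \<subseteq> insert w S" if "x \<in> S" "y \<in> S" for x y
    using that assms(1) unfolding path_connected_in_def by blast
  show ?thesis
    unfolding path_connected_in_def using from_w to_w w_w S_S by blast
qed

text \<open>Connectivity supplies a new vertex \<open>w\<close> adjacent to \<open>S\<close>, and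
  acyclicity leaves it only one neighbour there, so each step adds exactly two arcs.
  Path-connectedness is carried along for the uniqueness argument.\<close>

lemma tree_grow:
  assumes "connected (with_proj G)" "\<not> (\<exists>p. cycle p \<and> length p \<ge> 3)"
    and "m < card (pverts G)"
  shows "\<exists>S\<subseteq>pverts G. card S = Suc m \<and> card (parcs G \<inter> S \<times> S) = 2 * m \<and> path_connected_in S"
  using assms(3)
proof (induction m)
  case 0
  then obtain r where r: "r \<in> pverts G" by (metis card.empty ex_in_conv less_irrefl)
  have "parcs G \<inter> {r} \<times> {r} = {}" using no_loops' by blast
  moreover have "path_connected_in {r}"
    using r unfolding path_connected_in_def
    by (auto intro!: exI[of _ "[]"] simp: apath_Nil_iff)
  ultimately show ?case using r by (intro exI[of _ "{r}"]) auto
next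
  case (Suc m)
  then obtain S where S: "S \<subseteq> pverts G" "card S = Suc m" "card (parcs G \<inter> S \<times> S) = 2 * m"
    "path_connected_in S" by auto
  have fin: "finite S" using S(1) pair_finite_verts finite_subset by blast
  obtain r where "r \<in> S" using S(2) by (cases "S = {}") auto
  moreover have "\<not> pverts G \<subseteq> S"
    using S(2) Suc.prems card_mono[OF fin, of "pverts G"] by linarith
  ultimately obtain s w where sw: "(s, w) \<in> parcs G" "s \<in> S" "w \<notin> S"
    using connected_leaves_set[OF assms(1)] S(1) by blast
  then have ws: "(w, s) \<in> parcs G" using symmetric_arc_iff by blast
  have uniq: "x = s" if wx: "(w, x) \<in> parcs G" "x \<in> S" for x
  proof -
    obtain p where "apath x p s" "set (awalk_verts x p) \<subseteq> S"
      using S(4) wx(2) sw(2) unfolding path_connected_in_def by meson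
    then show ?thesis
      using acyclic_unique_neighbour[OF assms(2)] sw(3) wx(1) ws by blast
  qed
  have "parcs G \<inter> insert w S \<times> insert w S = parcs G \<inter> S \<times> S \<union> {(s, w), (w, s)}"
    using sw(1,2) ws uniq no_loops' symmetric_arc_iff by blast
  moreover have "finite (parcs G \<inter> S \<times> S)" using pair_finite_arcs by blast
  moreover have "parcs G \<inter> S \<times> S \<inter> {(s, w), (w, s)} = {}" "s \<noteq> w" using sw by auto
  ultimately have "card (parcs G \<inter> insert w S \<times> insert w S) = 2 * Suc m"
    using S(3) by (simp add: card_Un_disjoint)
  moreover have "insert w S \<subseteq> pverts G" using S(1) sw(1) in_arcsD2 by blast
  moreover have "card (insert w S) = Suc (Suc m)" using S(2) fin sw(3) by simp
  ultimately show ?case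
    using path_connected_in_insert[OF S(4) ws sw(2,3)] by blast
qed

text \<open>Growing up to \<open>m = card (pverts G) - 1\<close> exhausts all vertices.\<close>

lemma tree_card_arcs:
  assumes "undirected_tree G"
  shows "card (parcs G) + 2 = 2 * card (pverts G)"
proof -
  have conn: "connected (with_proj G)" and acyc: "\<not> (\<exists>p. cycle p \<and> length p \<ge> 3)"
    using assms by (auto simp: undirected_tree_def)
  have "card (pverts G) > 0"
    using conn pair_finite_verts by (auto simp: connected_iff card_gt_0_iff)
  then have lt: "card (pverts G) - 1 < card (pverts G)" by simp
  then obtain S where S: "S \<subseteq> pverts G" "card S = card (pverts G)"
    "card (parcs G \<inter> S \<times> S) = 2 * (card (pverts G) - 1)"
    using tree_grow[OF conn acyc lt] by auto
  then have "S = pverts G" using pair_finite_verts card_subset_eq by blast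
  then have "parcs G \<inter> S \<times> S = parcs G" by (auto dest: in_arcsD1 in_arcsD2)
  then show ?thesis using S(3) lt by simp
qed

section \<open>Neighbours and arcs of prescribed degrees\<close>

lemma degree_one_neighbours:
  assumes "degree G u = 1" "(u, v) \<in> parcs G"
  shows "{w. (u, w) \<in> parcs G} = {v}"
proof -
  obtain x where "{w. (u, w) \<in> parcs G} = {x}"
    using assms(1) unfolding degree_eq_card by (rule card_1_singletonE)
  with assms(2) show ?thesis by auto
qed

lemma degree_two_neighbours:
  assumes "degree G u = 2" "(u, v) \<in> parcs G"
  obtains w where "w \<noteq> v" "{w. (u, w) \<in> parcs G} = {v, w}"
proof -
  obtain x y where xy: "{w. (u, w) \<in> parcs G} = {x, y}" "x \<noteq> y"
    using assms(1) unfolding degree_eq_card card_2_iff by blast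
  then have "v = x \<or> v = y" using assms(2) by blast
  then show thesis using that xy by (metis insert_commute)
qed

text \<open>The pairs are ordered, so an edge with both ends of degree \<open>i\<close> contributes
  two arcs to \<open>arcs_between i i\<close>.\<close>

definition arcs_between :: "nat \<Rightarrow> nat \<Rightarrow> ('a \<times> 'a) set" where
  "arcs_between i j = {(u, v) \<in> parcs G. degree G u = i \<and> degree G v = j}"

lemma finite_arcs_between: "finite (arcs_between i j)"
  by (rule finite_subset[OF _ pair_finite_arcs]) (auto simp: arcs_between_def)

lemma card_arcs_between_commute: "card (arcs_between i j) = card (arcs_between j i)"
proof -
  have "arcs_between j i = prod.swap ` arcs_between i j"
    using symmetric_arc_iff by (force simp: arcs_between_def)
  then show ?thesis by (simp add: card_image)
qed

lemma card_arcs_between_same: "card (arcs_between i i) = 2 * edge_count G i i"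
  unfolding twice_edge_count arcs_between_def by (rule arg_cong[of _ _ card]) auto

lemma sum_arcs_between:
  "(\<Sum>(u, v)\<in>arcs_between i j. (int (degree G u) - int (degree G v))\<^sup>2)
     = int (card (arcs_between i j)) * (int i - int j)\<^sup>2"
proof -
  have "(\<Sum>(u, v)\<in>arcs_between i j. (int (degree G u) - int (degree G v))\<^sup>2)
      = (\<Sum>_\<in>arcs_between i j. (int i - int j)\<^sup>2)"
    by (rule sum.cong) (auto simp: arcs_between_def)
  then show ?thesis by simp
qed

end

section \<open>Degree counts in the family\<close>

text \<open>The bound on \<Delta> keeps the degrees 1, 2 and \<Delta> distinct, so that the arc
  classes are disjoint.\<close>

locale T''_tree = pair_graph T for T :: "'a pair_pre_digraph" +
  fixes n \<Delta> :: nat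
  assumes T: "T \<in> family_T'' n \<Delta>" and \<Delta>: "\<Delta> \<ge> 3"
begin

lemma
  shows undirected_tree: "undirected_tree T"
    and connected: "connected (with_proj T)"
    and card_verts: "card (pverts T) = n"
    and degree_internal_leaf: "internal_leaf T v \<Longrightarrow> degree T v = \<Delta>"
    and degree_cases: "v \<in> pverts T \<Longrightarrow> degree T v = 1 \<or> degree T v = 2 \<or> degree T v = \<Delta>"
    and edge_count_22: "edge_count T 2 2 = 0"
    and edge_count_\<Delta>\<Delta>: "edge_count T \<Delta> \<Delta> \<le> \<Delta> - 1"
  using T by (auto simp: family_T''_def undirected_tree_def)

section \<open>Neighbours of vertices of degree 1 and 2\<close>

lemma ex_degree_\<Delta>: "\<exists>x\<in>pverts T. degree T x = \<Delta>"
proof -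
  have "pverts T \<noteq> {}" using connected by (simp add: connected_iff)
  then have "max_degree T \<in> degree T ` pverts T"
    unfolding max_degree_def using pair_finite_verts by (intro Max_in) auto
  then show ?thesis using T by (auto simp: family_T''_def)
qed

text \<open>A vertex of degree \<Delta> lies outside \<open>S\<close>, so connectivity forces an arc
  out of \<open>S\<close>. This excludes small components of low degree.\<close>

lemma low_degree_set_not_closed:
  assumes "S \<noteq> {}" "S \<subseteq> pverts T" "\<And>x. x \<in> S \<Longrightarrow> degree T x < \<Delta>"
  obtains x y where "(x, y) \<in> parcs T" "x \<in> S" "y \<notin> S"
proof -
  have "\<not> pverts T \<subseteq> S" using ex_degree_\<Delta> assms(3) by force
  moreover obtain u where "u \<in> S" using assms(1) by blast
  ultimately show thesis
    using connected_leaves_set[OF connected] assms(2) that by blast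
qed

lemma leaf_neighbour_not_leaf:
  assumes "(u, v) \<in> parcs T" "degree T u = 1"
  shows "degree T v \<noteq> 1"
proof
  assume v: "degree T v = 1"
  have vu: "(v, u) \<in> parcs T" using assms(1) symmetric_arc_iff by blast
  have "{u, v} \<subseteq> pverts T" using assms(1) in_arcsD1 in_arcsD2 by blast
  moreover have "degree T x < \<Delta>" if "x \<in> {u, v}" for x
    using that assms(2) v \<Delta> by auto
  ultimately obtain x y where xy: "(x, y) \<in> parcs T" "x \<in> {u, v}" "y \<notin> {u, v}"
    using low_degree_set_not_closed[of "{u, v}"] by blast
  then show False
    using degree_one_neighbours[OF assms(2,1)] degree_one_neighbours[OF v vu] by auto
qed

text \<open>If the other neighbour \<open>w\<close> of \<open>v\<close> has degree above 1, then
  \<open>v\<close> is an internal leaf of degree 2 instead of \<Delta>. Otherwise \<open>u\<close>,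
  \<open>v\<close>, \<open>w\<close> would form a whole component without a vertex of degree
  \<Delta>.\<close>

lemma leaf_neighbour_degree_not_2:
  assumes "(u, v) \<in> parcs T" "degree T u = 1"
  shows "degree T v \<noteq> 2"
proof
  assume v: "degree T v = 2"
  have vu: "(v, u) \<in> parcs T" using assms(1) symmetric_arc_iff by blast
  obtain w where w: "w \<noteq> u" "{x. (v, x) \<in> parcs T} = {u, w}"
    using degree_two_neighbours[OF v vu] by blast
  then have vw: "(v, w) \<in> parcs T" by blast
  then have wv: "(w, v) \<in> parcs T" using symmetric_arc_iff by blast
  have verts: "{u, v, w} \<subseteq> pverts T" using assms(1) vw in_arcsD1 in_arcsD2 by blast
  show False
  proof (cases "degree T w > 1")
    case True
    have "\<exists>!x. (v, x) \<in> parcs T \<and> degree T x > 1"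
    proof (rule ex1I)
      fix x assume "(v, x) \<in> parcs T \<and> degree T x > 1"
      then have "x \<in> {u, w}" "x \<noteq> u" using w(2) assms(2) by auto
      then show "x = w" by blast
    qed (use vw True in blast)
    then have "internal_leaf T v" using verts v by (simp add: internal_leaf_def)
    then show False using degree_internal_leaf v \<Delta> by fastforce
  next
    case False
    then have w1: "degree T w = 1" using degree_cases[of w] verts \<Delta> by auto
    have "degree T x < \<Delta>" if "x \<in> {u, v, w}" for x
      using that assms(2) v w1 \<Delta> by auto
    then obtain x y where "(x, y) \<in> parcs T" "x \<in> {u, v, w}" "y \<notin> {u, v, w}"
      using low_degree_set_not_closed[of "{u, v, w}"] verts by blast
    then show False
      using degree_one_neighbours[OF assms(2,1)] degree_one_neighbours[OF w1 wv] w(2) by auto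
  qed
qed

lemma no_arc_22: "arcs_between 2 2 = {}"
  using card_arcs_between_same[of 2] edge_count_22 finite_arcs_between by simp

lemma neighbour_degree_\<Delta>:
  assumes "(u, v) \<in> parcs T" "degree T u \<noteq> \<Delta>"
  shows "degree T v = \<Delta>"
proof (rule ccontr)
  assume v: "degree T v \<noteq> \<Delta>"
  have vu: "(v, u) \<in> parcs T" using assms(1) symmetric_arc_iff by blast
  have "degree T u = 1 \<or> degree T u = 2" "degree T v = 1 \<or> degree T v = 2"
    using degree_cases[of u] degree_cases[of v] v assms in_arcsD1 in_arcsD2 by blast+
  moreover have "\<not> (degree T u = 2 \<and> degree T v = 2)"
    using no_arc_22 assms(1) by (auto simp: arcs_between_def)
  ultimately show False
    using leaf_neighbour_not_leaf[OF assms(1)] leaf_neighbour_degree_not_2[OF assms(1)]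
      leaf_neighbour_not_leaf[OF vu] leaf_neighbour_degree_not_2[OF vu] by blast
qed

section \<open>Arc and vertex counts by degree\<close>

lemma arcs_partition:
  "parcs T = arcs_between 1 \<Delta> \<union> (arcs_between 2 \<Delta> \<union>
     (arcs_between \<Delta> 1 \<union> (arcs_between \<Delta> 2 \<union> arcs_between \<Delta> \<Delta>)))"
proof -
  have "(u, v) \<in> arcs_between 1 \<Delta> \<union> (arcs_between 2 \<Delta> \<union>
     (arcs_between \<Delta> 1 \<union> (arcs_between \<Delta> 2 \<union> arcs_between \<Delta> \<Delta>)))"
    if uv: "(u, v) \<in> parcs T" for u v
    using uv neighbour_degree_\<Delta>[OF uv] degree_cases[of u] degree_cases[of v]
      in_arcsD1[OF uv] in_arcsD2[OF uv]
    by (auto simp: arcs_between_def)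
  then show ?thesis by (auto simp: arcs_between_def)
qed

text \<open>The codomain stays general: the splitting serves both to count arcs in
  \<open>nat\<close> and to sum squares in \<open>int\<close>.\<close>

lemma sum_arcs_partition:
  fixes g :: "'a \<times> 'a \<Rightarrow> 'b::comm_monoid_add"
  shows "sum g (parcs T) = sum g (arcs_between 1 \<Delta>) + (sum g (arcs_between 2 \<Delta>) +
    (sum g (arcs_between \<Delta> 1) + (sum g (arcs_between \<Delta> 2) + sum g (arcs_between \<Delta> \<Delta>))))"
proof -
  have "arcs_between i j \<inter> arcs_between i' j' = {}" if "(i, j) \<noteq> (i', j')" for i j i' j'
    using that by (auto simp: arcs_between_def)
  then show ?thesis
    unfolding arg_cong[OF arcs_partition, of "sum g"]
    using \<Delta> by (simp add: sum.union_disjoint finite_arcs_between Int_Un_distrib)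
qed

lemma card_arcs_from_degree:
  "card {(u, v) \<in> parcs T. degree T u = i} = i * card {v \<in> pverts T. degree T v = i}"
proof -
  have "{(u, v) \<in> parcs T. degree T u = i}
      = {(u, v) \<in> parcs T. u \<in> {v \<in> pverts T. degree T v = i}}"
    by (auto dest: in_arcsD1)
  then show ?thesis
    by (rule ssubst[of _ _ "\<lambda>S. card S = _"]) (rule card_arcs_from, auto)
qed

lemma card_arcs_from_low_degree:
  assumes "i \<noteq> \<Delta>"
  shows "card (arcs_between i \<Delta>) = i * card {v \<in> pverts T. degree T v = i}"
proof -
  have "arcs_between i \<Delta> = {(u, v) \<in> parcs T. degree T u = i}"
    using neighbour_degree_\<Delta> assms by (auto simp: arcs_between_def)
  then show ?thesis using card_arcs_from_degree by simp
qed

lemma card_arcs_from_\<Delta>: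
  "\<Delta> * card {v \<in> pverts T. degree T v = \<Delta>}
     = card (arcs_between \<Delta> 1) + card (arcs_between \<Delta> 2) + card (arcs_between \<Delta> \<Delta>)"
proof -
  have "{(u, v) \<in> parcs T. degree T u = \<Delta>}
      = arcs_between \<Delta> 1 \<union> (arcs_between \<Delta> 2 \<union> arcs_between \<Delta> \<Delta>)"
    using degree_cases by (auto simp: arcs_between_def dest: in_arcsD2)
  moreover have "arcs_between \<Delta> 1 \<inter> (arcs_between \<Delta> 2 \<union> arcs_between \<Delta> \<Delta>) = {}"
    "arcs_between \<Delta> 2 \<inter> arcs_between \<Delta> \<Delta> = {}"
    using \<Delta> by (auto simp: arcs_between_def)
  ultimately show ?thesis
    using card_arcs_from_degree[of \<Delta>] by (simp add: card_Un_disjoint finite_arcs_between)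
qed

lemma card_verts_by_degree:
  "n = card {v \<in> pverts T. degree T v = 1} + card {v \<in> pverts T. degree T v = 2}
     + card {v \<in> pverts T. degree T v = \<Delta>}"
proof -
  have "pverts T = {v \<in> pverts T. degree T v = 1} \<union> ({v \<in> pverts T. degree T v = 2}
      \<union> {v \<in> pverts T. degree T v = \<Delta>})"
    using degree_cases by blast
  moreover have "card \<dots> = card {v \<in> pverts T. degree T v = 1} + card {v \<in> pverts T. degree T v = 2}
     + card {v \<in> pverts T. degree T v = \<Delta>}"
    using \<Delta> pair_finite_verts by (subst card_Un_disjoint; (subst card_Un_disjoint)?; auto)
  ultimately show ?thesis using card_verts by metis
qed

text \<open>Both equations are additive to avoid truncated subtraction; they fix the numbers of
  vertices of degree 2 and 1.\<close>

lemma degree_counts: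
  assumes "n = k * \<Delta> + 1 + j" "1 \<le> j" "j \<le> \<Delta> - 1"
  shows "card {v \<in> pverts T. degree T v = 2} + \<Delta> = k + j"
    and "card {v \<in> pverts T. degree T v = 1} + k + 1 + (k + j) = n + \<Delta>"
proof -
  define n1 n2 N c where "n1 = card {v \<in> pverts T. degree T v = 1}"
    and "n2 = card {v \<in> pverts T. degree T v = 2}"
    and "N = card {v \<in> pverts T. degree T v = \<Delta>}"
    and "c = edge_count T \<Delta> \<Delta>"
  have arcs: "card (arcs_between 1 \<Delta>) = n1" "card (arcs_between \<Delta> 1) = n1"
    "card (arcs_between 2 \<Delta>) = 2 * n2" "card (arcs_between \<Delta> 2) = 2 * n2"
    "card (arcs_between \<Delta> \<Delta>) = 2 * c"
    using card_arcs_from_low_degree[of 1] card_arcs_from_low_degree[of 2] \<Delta>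
      card_arcs_between_commute[of \<Delta> 1] card_arcs_between_commute[of \<Delta> 2]
      card_arcs_between_same[of \<Delta>]
    by (simp_all add: n1_def n2_def c_def)
  have deg: "\<Delta> * N = n1 + 2 * n2 + 2 * c"
    using card_arcs_from_\<Delta> arcs by (simp add: N_def)
  have "card (parcs T) = 2 * n1 + 4 * n2 + 2 * c"
    using sum_arcs_partition[of "\<lambda>_. 1 :: nat"] arcs by simp
  then have edges: "n1 + 2 * n2 + c + 1 = n"
    using tree_card_arcs[OF undirected_tree] card_verts by simp
  have verts: "n = n1 + n2 + N"
    using card_verts_by_degree by (simp add: n1_def n2_def N_def)
  have eq: "\<Delta> * N = k * \<Delta> + j + c" using deg edges assms(1) by simp
  have c: "c \<le> \<Delta> - 1" using edge_count_\<Delta>\<Delta> by (simp add: c_def)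
  \<comment> \<open>Since \<open>0 < j + c < 2 * \<Delta>\<close>, the product
    \<open>\<Delta> * N\<close> lies strictly between \<open>\<Delta> * k\<close> and
    \<open>\<Delta> * (k + 2)\<close>.\<close>
  have "\<Delta> * k < \<Delta> * N" using eq assms(2) by (simp add: mult.commute)
  then have "k < N" by simp
  moreover have "\<Delta> * N < \<Delta> * (k + 2)"
    using eq assms(2,3) c \<Delta> by (simp add: algebra_simps)
  then have "N < k + 2" unfolding mult_less_cancel1 by blast
  ultimately have N: "N = k + 1" by simp
  then have "c + j = \<Delta>" using eq by (simp add: algebra_simps)
  \<comment> \<open>Comparing \<open>verts\<close> with \<open>edges\<close> gives
    \<open>n2 + c + 1 = N\<close>, which yields \<open>n2\<close> and then
    \<open>n1\<close>.\<close>
  then show "n2 + \<Delta> = k + j" "n1 + k + 1 + (k + j) = n + \<Delta>"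
    using N verts edges by linarith+
qed

lemma sigma_eq:
  assumes "n = k * \<Delta> + 1 + j" "1 \<le> j" "j \<le> \<Delta> - 1"
  shows "sigma T = (int n + int \<Delta> - 2 * int k - 1 - int j) * (int \<Delta> - 1)\<^sup>2
    + 2 * (int k + int j - int \<Delta>) * (int \<Delta> - 2)\<^sup>2"
proof -
  define n1 n2 where "n1 = card {v \<in> pverts T. degree T v = 1}"
    and "n2 = card {v \<in> pverts T. degree T v = 2}"
  have arcs: "card (arcs_between 1 \<Delta>) = n1" "card (arcs_between \<Delta> 1) = n1"
    "card (arcs_between 2 \<Delta>) = 2 * n2" "card (arcs_between \<Delta> 2) = 2 * n2"
    using card_arcs_from_low_degree[of 1] card_arcs_from_low_degree[of 2] \<Delta>
      card_arcs_between_commute[of \<Delta> 1] card_arcs_between_commute[of \<Delta> 2]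
    by (simp_all add: n1_def n2_def)
  \<comment> \<open>Arcs between two vertices of degree \<Delta> contribute zero; the other classes
    come in pairs of opposite orientation.\<close>
  have "2 * sigma T = 2 * (int n1 * (int \<Delta> - 1)\<^sup>2 + 2 * int n2 * (int \<Delta> - 2)\<^sup>2)"
    unfolding twice_sigma sum_arcs_partition sum_arcs_between arcs
    by (simp add: power2_commute algebra_simps)
  moreover have "int n2 = int k + int j - int \<Delta>"
    "int n1 = int n + int \<Delta> - 2 * int k - 1 - int j"
    using degree_counts[OF assms] unfolding n1_def n2_def by linarith+
  ultimately show ?thesis by simp
qed

end

section \<open>Trees on initial segments of the naturals\<close>

text \<open>A tree with root 0 given by parents. Once parents are smaller than children, the order
  on the naturals yields walks to the root by induction and excludes cycles by looking at a largest
  vertex.\<close>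

definition parent_graph :: "nat \<Rightarrow> (nat \<Rightarrow> nat) \<Rightarrow> nat pair_pre_digraph" where
  "parent_graph n p = \<lparr>pverts = {..<n},
     parcs = {(u, v). (1 \<le> u \<and> u < n \<and> v = p u) \<or> (1 \<le> v \<and> v < n \<and> u = p v)}\<rparr>"

locale parent_tree =
  fixes n :: nat and p :: "nat \<Rightarrow> nat"
  assumes n_pos: "n > 0" and parent_less: "1 \<le> v \<Longrightarrow> v < n \<Longrightarrow> p v < v"
begin

abbreviation "G \<equiv> parent_graph n p"

lemma pverts_G [simp]: "pverts G = {..<n}"
  by (simp add: parent_graph_def)

lemma arc_iff:
  "(u, v) \<in> parcs G \<longleftrightarrow> (1 \<le> u \<and> u < n \<and> v = p u) \<or> (1 \<le> v \<and> v < n \<and> u = p v)"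
  by (simp add: parent_graph_def)

lemma arcD: "(u, v) \<in> parcs G \<Longrightarrow> u < n \<and> v < n \<and> u \<noteq> v"
  using parent_less by (fastforce simp: arc_iff)

lemma pair_graph_G: "pair_graph G"
proof
  show "finite (pverts G)" by simp
  have "parcs G \<subseteq> {..<n} \<times> {..<n}" using arcD by auto
  then show "finite (parcs G)" by (rule finite_subset) simp
  show "symmetric (with_proj G)"
    by (auto simp: symmetric_def sym_def arc_iff)
qed (use arcD in auto)

sublocale pair_graph G by (rule pair_graph_G)

lemma awalk_root: "v < n \<Longrightarrow> \<exists>q. awalk v q 0"
proof (induction v rule: less_induct)
  case (less v)
  show ?case
  proof (cases "v = 0")
    case True
    then show ?thesis using n_pos by (intro exI[of _ "[]"]) (simp add: awalk_Nil_iff)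
  next
    case False
    then have "p v < v" using less.prems parent_less by simp
    then obtain q where "awalk (p v) q 0" using less by force
    moreover have "(v, p v) \<in> parcs G" using False less.prems by (simp add: arc_iff)
    ultimately have "awalk v ((v, p v) # q) 0" by (simp add: awalk_Cons_iff)
    then show ?thesis by blast
  qed
qed

lemma connected_G: "connected (with_proj G)"
proof -
  have "\<exists>q. awalk u q v" if uv: "u < n" "v < n" for u v
  proof -
    obtain q q' where "awalk u q 0" "awalk v q' 0" using awalk_root uv by blast
    then have "awalk u (q @ rev_path q') v"
      by (intro awalk_appendI[of u q 0]) auto
    then show ?thesis by blast
  qed
  then show ?thesis using n_pos by (auto simp: connected_iff)
qed

lemma cycle_rotate_Max:
  assumes "cycle c"
  obtains m c' where "awalk m c' m" "distinct (map snd c')" "length c' = length c"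
    "\<And>e. e \<in> set c' \<Longrightarrow> fst e \<le> m \<and> snd e \<le> m"
proof -
  obtain u where u: "awalk u c u" "distinct (tl (awalk_verts u c))" "c \<noteq> []"
    using assms by (auto simp: cycle_def)
  \<comment> \<open>The vertices after the first are the heads of the arcs, so distinctness becomes
    a condition on \<open>map snd c\<close> that survives rotation.\<close>
  have tl: "tl (awalk_verts u c) = map snd c"
    using u awalk_verts_conv'[of u c u] by (auto simp: awalk_def)
  define m where "m = Max (set (awalk_verts u c))"
  have "awalk_verts u c \<noteq> []" by (cases c) auto
  then have m: "m \<in> set (awalk_verts u c)" unfolding m_def by simp
  obtain q r where qr: "c = q @ r" "awalk u q m" "awalk m r u"
    using awalk_decomp[OF u(1) m] by blast
  show thesis
  proof (rule that)
    show "awalk m (r @ q) m" using qr by (intro awalk_appendI)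
    have "distinct (map snd c)" using u(2) tl by simp
    then show "distinct (map snd (r @ q))" unfolding qr(1) by auto
    show "length (r @ q) = length c" using qr(1) by simp
    fix e assume "e \<in> set (r @ q)"
    then have "e \<in> set c" using qr(1) by auto
    then have "fst e \<in> set (awalk_verts u c)" "snd e \<in> set (awalk_verts u c)"
      using awalk_verts_arc1 awalk_verts_arc2[OF u(1)] by auto
    then show "fst e \<le> m \<and> snd e \<le> m" unfolding m_def by simp
  qed
qed

text \<open>
  Both neighbours of the largest vertex of a cycle would be its parent, hence equal.
\<close>

lemma no_long_cycle: "\<not> (\<exists>c. cycle c \<and> length c \<ge> 3)"
proof
  assume "\<exists>c. cycle c \<and> length c \<ge> 3"
  then obtain m c where c: "awalk m c m" "distinct (map snd c)" "length c \<ge> 3"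
    and le: "\<And>e. e \<in> set c \<Longrightarrow> fst e \<le> m \<and> snd e \<le> m"
    using cycle_rotate_Max by (metis (no_types, lifting))
  obtain e1 c1 where c1: "c = e1 # c1" using c(3) by (cases c) auto
  then obtain e2 mid where c2: "c = e1 # mid @ [e2]"
    using c(3) by (cases c1 rule: rev_cases) auto
  have e1: "e1 \<in> parcs G" "fst e1 = m" using c(1) c2 by (auto simp: awalk_Cons_iff)
  have e2: "e2 \<in> parcs G" "snd e2 = m"
    using c(1) c2 by (auto simp: awalk_Cons_iff awalk_Nil_iff)
  have "snd e1 = p m"
    using e1 le[of e1] c2 arc_iff[of "fst e1" "snd e1"] parent_less[of "snd e1"] by force
  have "fst e2 = p m"
    using e2 le[of e2] c2 arc_iff[of "fst e2" "snd e2"] parent_less[of "fst e2"] by force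
  \<comment> \<open>Length at least 3 provides an arc \<open>e3\<close> before \<open>e2\<close>
    other than \<open>e1\<close>. Both \<open>e1\<close> and \<open>e3\<close> have head
    \<open>p m\<close>, contradicting distinct heads.\<close>
  obtain e3 mid' where mid: "mid = mid' @ [e3]"
    using c(3) c2 by (cases mid rule: rev_cases) auto
  have "snd e3 = fst e2"
    using c(1) c2 mid by (auto simp: awalk_Cons_iff awalk_verts_conv)
  then have "snd e3 = snd e1" using \<open>snd e1 = p m\<close> \<open>fst e2 = p m\<close> by simp
  then show False using c(2) c2 mid by simp
qed

lemma undirected_tree_G: "undirected_tree G"
  unfolding undirected_tree_def using pair_graph_G connected_G no_long_cycle by blast

lemma edges_G: "edges G = (\<lambda>v. {v, p v}) ` {1..<n}"
proof -
  have "{v, p v} \<in> edges G" if "1 \<le> v" "v < n" for v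
    using that arc_iff[of v "p v"] by (auto simp: edges_def)
  then show ?thesis by (auto simp: edges_def arc_iff)
qed

lemma degree_G:
  assumes "v < n"
  shows "degree G v = (if v = 0 then 0 else 1) + card {u. 1 \<le> u \<and> u < n \<and> p u = v}"
proof -
  have "{u. (v, u) \<in> parcs G} = (if v = 0 then {} else {p v}) \<union> {u. 1 \<le> u \<and> u < n \<and> p u = v}"
    using assms by (auto simp: arc_iff)
  moreover have "(if v = 0 then {} else {p v}) \<inter> {u. 1 \<le> u \<and> u < n \<and> p u = v} = {}"
    using parent_less[of v] parent_less[of "p v"] assms by auto
  moreover have "finite {u. 1 \<le> u \<and> u < n \<and> p u = v}" by simp
  ultimately show ?thesis by (simp add: degree_eq_card card_Un_disjoint)
qed

end

section \<open>The caterpillar\<close>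

text \<open>
  A caterpillar with \<open>N\<close> vertices of degree \<open>\<Delta>\<close>, where the first \<open>t\<close> consecutive pairs of them are
  joined through a vertex of degree 2 and the other pairs directly. The vertices \<open>0, \<dots>, L - 1\<close>
  form a path whose two ends are leaves, \<open>spine q\<close> is the position of the \<open>q\<close>-th vertex of
  degree \<open>\<Delta>\<close>, and each of these carries \<open>\<Delta> - 2\<close> of the remaining leaves.
\<close>

locale caterpillar =
  fixes \<Delta> N t :: nat
  assumes \<Delta>: "\<Delta> \<ge> 3" and t_less: "t < N"
begin

definition L :: nat where "L = N + t + 2"
definition num_verts :: nat where "num_verts = L + N * (\<Delta> - 2)"
text \<open>Before the \<open>q\<close>-th spine vertex come the end leaf 0, \<open>q\<close> spine
  vertices and \<open>min q t\<close> vertices of degree 2, the latter at the even positions from 2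
  to \<open>2 * t\<close>.\<close>

definition spine :: "nat \<Rightarrow> nat" where "spine q = 1 + q + min q t"
text \<open>The numbers from \<open>L\<close> on form consecutive blocks of
  \<open>\<Delta> - 2\<close> leaves, one block per spine vertex.\<close>

definition par :: "nat \<Rightarrow> nat" where
  "par v = (if v < L then v - 1 else spine ((v - L) div (\<Delta> - 2)))"

lemma spine_bounds: "q < N \<Longrightarrow> 1 \<le> spine q \<and> spine q < L - 1"
  using t_less by (auto simp: spine_def L_def)

lemma spine_inj: "spine q = spine q' \<longleftrightarrow> q = q'"
  by (auto simp: spine_def min_def split: if_splits)

lemma leaf_index_less: "L \<le> v \<Longrightarrow> v < num_verts \<Longrightarrow> (v - L) div (\<Delta> - 2) < N"
  using \<Delta> by (auto simp: num_verts_def div_less_iff_less_mult)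

lemma par_bounds: "L \<le> v \<Longrightarrow> v < num_verts \<Longrightarrow> 1 \<le> par v \<and> par v < L - 1"
  using spine_bounds[OF leaf_index_less] by (simp add: par_def)

sublocale parent_tree num_verts par
proof
  show "num_verts > 0" by (simp add: num_verts_def L_def)
  fix v assume "1 \<le> v" "v < num_verts"
  then show "par v < v"
    using par_bounds[of v] by (cases "v < L") (auto simp: par_def)
qed

lemma L_le_num_verts: "L \<le> num_verts"
  by (simp add: num_verts_def)

lemma leaves_of_spine:
  assumes "q < N"
  shows "card {u. L \<le> u \<and> u < num_verts \<and> par u = spine q} = \<Delta> - 2"
proof -
  have "{u. L \<le> u \<and> u < num_verts \<and> par u = spine q}
      = {L + q * (\<Delta> - 2)..<L + (q + 1) * (\<Delta> - 2)}" (is "?A = ?B")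
  proof (intro set_eqI iffI)
    fix u assume "u \<in> ?A"
    then have u: "L \<le> u" "(u - L) div (\<Delta> - 2) = q" by (auto simp: par_def spine_inj)
    have "q * (\<Delta> - 2) \<le> u - L"
      using u(2) div_times_less_eq_dividend by blast
    moreover have "u - L < (q + 1) * (\<Delta> - 2)"
      using u(2) \<Delta> dividend_less_div_times[of "\<Delta> - 2" "u - L"] by (simp add: algebra_simps)
    ultimately show "u \<in> ?B" using u(1) by auto
  next
    fix u assume u: "u \<in> ?B"
    then have "L \<le> u" by auto
    have "(q + 1) * (\<Delta> - 2) \<le> N * (\<Delta> - 2)" using assms by (intro mult_le_mono1) simp
    then have "u < num_verts" using u by (auto simp: num_verts_def)
    have "(u - L) div (\<Delta> - 2) = q"
      using u \<open>L \<le> u\<close> by (intro div_nat_eqI) (auto simp: algebra_simps)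
    then show "u \<in> ?A" using \<open>L \<le> u\<close> \<open>u < num_verts\<close> by (simp add: par_def)
  qed
  then show ?thesis by simp
qed

text \<open>Position \<open>L - 1\<close> is the far end of the path, hence a leaf like the vertices
  from \<open>L\<close> on. A spine vertex has two path neighbours and \<open>\<Delta> - 2\<close>
  hanging leaves.\<close>

lemma degree_eq:
  assumes "v < num_verts"
  shows "degree G v = (if v = 0 \<or> L - 1 \<le> v then 1 else if even v \<and> v \<le> 2 * t then 2 else \<Delta>)"
proof -
  let ?C = "{u. L \<le> u \<and> u < num_verts \<and> par u = v}"
  have split: "{u. 1 \<le> u \<and> u < num_verts \<and> par u = v} = (if v + 1 < L then {v + 1} else {}) \<union> ?C"
    using L_le_num_verts \<Delta> by (auto simp: par_def L_def)
  have "(if v + 1 < L then {v + 1} else {}) \<inter> ?C = {}" by auto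
  moreover have "finite ?C" by simp
  ultimately have deg: "degree G v = (if v = 0 then 0 else 1) + ((if v + 1 < L then 1 else 0) + card ?C)"
    using degree_G[OF assms] unfolding split by (simp add: card_Un_disjoint)
  consider (ends) "v = 0 \<or> L - 1 \<le> v" | (two) "1 \<le> v" "v < L - 1" "even v" "v \<le> 2 * t"
    | (spine) q where "q < N" "v = spine q" "1 \<le> v" "v < L - 1" "\<not> (even v \<and> v \<le> 2 * t)"
  proof -
    have ex: "\<exists>q<N. v = spine q" if v: "1 \<le> v" "v < L - 1" "\<not> (even v \<and> v \<le> 2 * t)"
    proof (cases "v \<le> 2 * t + 1")
      case True
      then have "odd v" using v(3) by (cases "v = 2 * t + 1") auto
      then obtain q where "v = 2 * q + 1" by (rule oddE)
      then show ?thesis using True t_less by (intro exI[of _ q]) (simp add: spine_def)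
    next
      case False
      \<comment> \<open>Past position \<open>2 * t + 1\<close> the path consists of consecutive
        spine vertices, where \<open>spine q = 1 + q + t\<close>.\<close>
      then show ?thesis using v(2) by (intro exI[of _ "v - 1 - t"]) (auto simp: spine_def L_def)
    qed
    show thesis using ends two spine ex by (metis leI less_one not_le)
  qed
  then show ?thesis
  proof cases
    case ends
    have C: "?C = {}"
      using ends par_bounds by (fastforce simp: L_def)
    show ?thesis using ends deg unfolding C by (auto simp: L_def)
  next
    case two
    have "par u \<noteq> v" if u: "L \<le> u" "u < num_verts" for u
    proof
      assume "par u = v"
      then have "v = spine ((u - L) div (\<Delta> - 2))" using u by (simp add: par_def)
      then show False using two(3,4) by (auto simp: spine_def min_def split: if_splits)
    qed
    then have C: "?C = {}" by auto
    show ?thesis using two deg unfolding C by auto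
  next
    case spine
    have C: "card ?C = \<Delta> - 2" using leaves_of_spine[OF spine(1)] spine(2) by simp
    show ?thesis using spine(3-5) deg \<Delta> unfolding C by auto
  qed
qed

text \<open>If the child end of an edge is no leaf, the edge joins consecutive path positions; this
  reduces both edge counts to parity.\<close>

lemma edge_below_L:
  assumes "1 \<le> v" "v < num_verts" "degree G v \<noteq> 1"
  shows "v < L - 1" "par v = v - 1"
  using degree_eq[OF assms(2)] assms(1,3) by (auto simp: par_def split: if_splits)

lemma edge_count_22: "edge_count G 2 2 = 0"
proof -
  have "degree G ` {v, par v} \<noteq> {2, 2}" if v: "1 \<le> v" "v < num_verts" for v
  proof
    assume "degree G ` {v, par v} = {2, 2}"
    then have d: "degree G v = 2" "degree G (par v) = 2" by auto
    have "v < L - 1" "par v = v - 1" using edge_below_L[of v] v d by auto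
    then have "(if v - 1 = 0 \<or> L - 1 \<le> v - 1 then 1 else if even (v - 1) \<and> v - 1 \<le> 2 * t then 2 else \<Delta>) = 2"
      using d degree_eq[of "v - 1"] v by simp
    then have "even (v - 1)" using \<Delta> by (simp split: if_splits)
    moreover have "even v" using d degree_eq[of v] v \<Delta> by (auto split: if_splits)
    ultimately show False using v by simp
  qed
  then have "{e \<in> edges G. degree G ` e = {2, 2}} = {}" unfolding edges_G by auto
  then show ?thesis unfolding edge_count_def by (simp only: card.empty)
qed

lemma edge_count_\<Delta>\<Delta>: "edge_count G \<Delta> \<Delta> \<le> N - 1 - t"
proof -
  have "v \<in> {2 * t + 2..N + t}"
    if v: "1 \<le> v" "v < num_verts" "degree G ` {v, par v} = {\<Delta>, \<Delta>}" for v
  proof -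
    have d: "degree G v = \<Delta>" "degree G (par v) = \<Delta>" using v(3) by auto
    then have lt: "v < L - 1" "par v = v - 1" using edge_below_L[of v] v \<Delta> by auto
    have "\<not> (even v \<and> v \<le> 2 * t)" using d degree_eq[of v] v \<Delta> by (auto split: if_splits)
    moreover have "(if v - 1 = 0 \<or> L - 1 \<le> v - 1 then 1 else if even (v - 1) \<and> v - 1 \<le> 2 * t then 2 else \<Delta>) = \<Delta>"
      using d lt degree_eq[of "v - 1"] v by simp
    then have "v \<noteq> 1" "\<not> (even (v - 1) \<and> v - 1 \<le> 2 * t)" using \<Delta> by (auto split: if_splits)
    \<comment> \<open>One of \<open>v - 1\<close> and \<open>v\<close> is even, and that one must
      exceed \<open>2 * t\<close>.\<close>
    ultimately have "2 * t + 2 \<le> v" using v(1) by presburger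
    then show ?thesis using lt(1) by (simp add: L_def)
  qed
  then have "{e \<in> edges G. degree G ` e = {\<Delta>, \<Delta>}} \<subseteq> (\<lambda>v. {v, par v}) ` {2 * t + 2..N + t}"
    unfolding edges_G by auto
  then have "edge_count G \<Delta> \<Delta> \<le> card ((\<lambda>v. {v, par v}) ` {2 * t + 2..N + t})"
    unfolding edge_count_def by (intro card_mono) auto
  also have "\<dots> \<le> card {2 * t + 2..N + t}" by (intro card_image_le) simp
  finally show ?thesis by simp
qed

text \<open>A vertex of degree 2 lies between two spine vertices, so it has two neighbours of degree
  above 1.\<close>

lemma degree_internal_leaf:
  assumes "internal_leaf G v"
  shows "degree G v = \<Delta>"
proof (rule ccontr)
  assume "degree G v \<noteq> \<Delta>"
  moreover have v: "v < num_verts" "degree G v \<ge> 2" "\<exists>!u. (v, u) \<in> parcs G \<and> degree G u > 1"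
    using assms by (auto simp: internal_leaf_def)
  ultimately have "1 \<le> v" "v < L - 1" "even v" "v \<le> 2 * t"
    using degree_eq[OF v(1)] by (auto split: if_splits)
  then have "2 \<le> v" "v + 1 < L - 1" using t_less by (auto simp: L_def elim: evenE)
  then have "(v, v - 1) \<in> parcs G \<and> degree G (v - 1) > 1" "(v, v + 1) \<in> parcs G \<and> degree G (v + 1) > 1"
    using degree_eq[of "v - 1"] degree_eq[of "v + 1"] L_le_num_verts \<Delta>
    by (auto simp: arc_iff par_def)
  with v(3) have "v - 1 = v + 1" by blast
  then show False by simp
qed

lemma max_degree_G: "max_degree G = \<Delta>"
proof -
  have "degree G 1 = \<Delta>" using degree_eq[of 1] t_less L_le_num_verts by (simp add: L_def)
  then have "\<Delta> \<in> degree G ` pverts G" using L_le_num_verts by (intro image_eqI[of _ _ 1]) (auto simp: L_def)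
  moreover have "degree G v \<le> \<Delta>" if "v < num_verts" for v using degree_eq[OF that] \<Delta> by auto
  ultimately show ?thesis unfolding max_degree_def by (intro Max_eqI) auto
qed

text \<open>The assumption turns the bound \<open>N - 1 - t\<close> on the edges between spine
  vertices into \<open>\<Delta> - 1\<close>.\<close>

lemma caterpillar_in_family:
  assumes "N \<le> t + \<Delta>"
  shows "G \<in> family_T'' num_verts \<Delta>"
proof -
  have "degree G v \<in> {1, 2, \<Delta>}" if "v < num_verts" for v
    unfolding degree_eq[OF that] by simp
  moreover have "edge_count G \<Delta> \<Delta> \<le> \<Delta> - 1" using edge_count_\<Delta>\<Delta> assms by linarith
  ultimately show ?thesis
    unfolding family_T''_def mem_Collect_eq
    using undirected_tree_G max_degree_G degree_internal_leaf edge_count_22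
    by (simp only: pverts_G card_lessThan) blast
qed

end

text \<open>Non-emptiness is claimed over \<open>nat\<close>, since a small finite vertex type may
  admit no such tree; the equality compares trees across arbitrary vertex types.\<close>

theorem proposition6:
  fixes \<Delta> n k j :: nat
  assumes "\<Delta> \<ge> 6"
    and "n = k * \<Delta> + 1 + j"
    and "k \<ge> \<Delta> - 1"
    and "1 \<le> j" and "j \<le> \<Delta> - 1"
  shows "(family_T'' n \<Delta> :: nat pair_pre_digraph set) \<noteq> {} \<and>
    (\<forall>T \<in> (family_T'' n \<Delta> :: 'a pair_pre_digraph set).
     \<forall>T' \<in> (family_T'' n \<Delta> :: 'b pair_pre_digraph set). sigma T = sigma T')"
proof (intro conjI ballI)
  have j: "j < \<Delta>" and kj: "\<Delta> \<le> k + j" using assms by auto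
  \<comment> \<open>These are the numbers of vertices of degree \<Delta> and 2 forced by
    \<open>degree_counts\<close>; \<open>kj\<close> keeps the subtraction from truncating.\<close>
  interpret caterpillar \<Delta> "k + 1" "k + j - \<Delta>"
    using assms(1) j kj by unfold_locales auto
  \<comment> \<open>Substituting \<open>2 + d\<close> removes the truncated subtraction
    \<open>\<Delta> - 2\<close>.\<close>
  obtain d where d: "\<Delta> = 2 + d" using assms(1) le_Suc_ex[of 2 \<Delta>] by auto
  have "num_verts = k + 1 + (k + j - \<Delta>) + 2 + (k + 1) * (\<Delta> - 2)"
    by (simp only: num_verts_def L_def)
  also have "\<dots> = n"
    using kj unfolding assms(2) d by (simp add: algebra_simps)
  finally have "num_verts = n" .
  then show "(family_T'' n \<Delta> :: nat pair_pre_digraph set) \<noteq> {}"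
    using caterpillar_in_family assms(4) kj by auto
next
  fix T :: "'a pair_pre_digraph" and T' :: "'b pair_pre_digraph"
  assume T: "T \<in> family_T'' n \<Delta>" "T' \<in> family_T'' n \<Delta>"
  then have "pair_graph T" "pair_graph T'" by (auto simp: family_T''_def undirected_tree_def)
  then have "T''_tree T n \<Delta>" "T''_tree T' n \<Delta>"
    using T assms(1) by (auto simp: T''_tree_def T''_tree_axioms_def)
  from T''_tree.sigma_eq[OF this(1) assms(2,4,5)] T''_tree.sigma_eq[OF this(2) assms(2,4,5)]
  show "sigma T = sigma T'" by simp
qed

end
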